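(* Let $\xi \in \mathbb{R} \setminus \mathbb{Q}$, and let $\alpha, \beta$ be real numbers such that $0 < \alpha < 1$, $\beta > 1$ and $\mu(\xi) < 1 - \frac{\log \beta}{\log \alpha}$. Then there exist integer sequences $(u_n)_{n \geq 1}$ and $(v_n)_{n \geq 1}$ such that $$\lim_{n\to +\infty} \frac{u_n \xi - v_n}{\alpha^n} = \lim_{n\to +\infty} \frac{u_n}{\beta^n} = 1,$$ and consequently $$\lim_{n\to +\infty} \frac{|u_{n+1}\xi - v_{n+1}|}{|u_{n}\xi - v_{n}|} = \lim_{n\to +\infty} |u_{n}\xi - v_{n}|^{1/n} = \alpha \quad\text{and}\quad \lim_{n\to +\infty} \frac{u_{n+1}}{u_{n}} = \lim_{n\to +\infty} |u_{n}|^{1/n} = \beta.$$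
   Context: For an irrational real number $\xi$, the irrationality exponent $\mu(\xi)$ is the infimum of all real numbers $\mu$ such that the inequality $|\xi - p/q| > q^{-\mu}$ holds for all integers $p, q$ with $q$ sufficiently large (it may be $+\infty$). *)

theory Defs
  imports Complex_Main "HOL-Library.Extended_Real"
begin

text \<open>Valued in \<^typ>\<open>ereal\<close>: the infimum of the empty set is \<^term>\<open>\<infinity> :: ereal\<close>, which is
  the value at Liouville numbers. Only the values at irrational numbers are meaningful. The
  filter \<^term>\<open>at_top :: int filter\<close> makes the denominators eventually positive, so
  \<open>powr\<close> is only relevant at a positive base.\<close>

definition irrationality_exponent :: "real \<Rightarrow> ereal" where
  "irrationality_exponent \<xi> =
     Inf (ereal ` {\<mu>. \<forall>\<^sub>F q :: int in at_top. \<forall>p :: int.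
       \<bar>\<xi> - real_of_int p / real_of_int q\<bar> > real_of_int q powr (- \<mu>)})"

end

theory Submission
  imports Defs "HOL-Analysis.Kronecker_Approximation_Theorem" "HOL-Number_Theory.Cong"
begin

text \<open>
  Fix \<open>1 < b < \<beta>\<close> and \<open>\<mu> > 1\<close> with \<open>\<mu>(\<xi>) < \<mu> < 1 - ln b / ln \<alpha>\<close>, and take a reduced Dirichlet
  approximation \<open>p/q\<close> of \<open>\<xi>\<close> with \<open>q \<le> b^n\<close> and \<open>|q \<xi> - p| < 1 / \<lfloor>b^n\<rfloor>\<close>. The lower bound
  \<open>|q \<xi> - p| \<ge> c q^(1 - \<mu>)\<close> forces \<open>q\<close> to be at least of order \<open>b^(n / (\<mu> - 1))\<close>, which grows
  faster than \<open>\<alpha>^(-n)\<close>. As \<open>k\<close> runs over \<open>q\<close> consecutive integers starting at \<open>\<lfloor>\<beta>^n\<rfloor>\<close>, the products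
  \<open>k p\<close> meet every residue class modulo \<open>q\<close>, so some \<open>k \<xi>\<close> lies within \<open>O(1/q) = o(\<alpha>^n)\<close> of
  \<open>\<alpha>^n\<close> modulo 1, while \<open>k - \<beta>^n = O(b^n) = o(\<beta>^n)\<close>.
\<close>

lemma tendsto_ratio_of_asymp_power:
  fixes x :: "nat \<Rightarrow> real"
  assumes "a > 0" and lim: "(\<lambda>n. x n / a ^ n) \<longlonglongrightarrow> 1"
  shows "(\<lambda>n. x (Suc n) / x n) \<longlonglongrightarrow> a"
proof -
  have "(\<lambda>n. a * ((x (Suc n) / a ^ Suc n) / (x n / a ^ n))) \<longlonglongrightarrow> a * (1 / 1)"
    by (intro tendsto_intros lim LIMSEQ_Suc[OF lim]) auto
  moreover have "(\<lambda>n. a * ((x (Suc n) / a ^ Suc n) / (x n / a ^ n))) = (\<lambda>n. x (Suc n) / x n)"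
    using \<open>a > 0\<close> by (simp add: fun_eq_iff)
  ultimately show ?thesis by (simp only: div_by_1 mult_1_right)
qed

text \<open>The normalised term \<open>x n / a ^ n\<close> tends to the nonzero limit 1 while the
  exponent \<open>1 / n\<close> tends to 0, so its n-th root tends to
  \<open>1 powr 0 = 1\<close>.\<close>

lemma tendsto_root_of_asymp_power:
  fixes x :: "nat \<Rightarrow> real"
  assumes "a > 0" and lim: "(\<lambda>n. x n / a ^ n) \<longlonglongrightarrow> 1"
  shows "(\<lambda>n. \<bar>x n\<bar> powr (1 / real n)) \<longlonglongrightarrow> a"
proof -
  have "(\<lambda>n. a * \<bar>x n / a ^ n\<bar> powr (1 / real n)) \<longlonglongrightarrow> a * \<bar>1\<bar> powr 0"
    by (intro tendsto_intros lim lim_1_over_n) auto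
  \<comment> \<open>At \<open>n = 0\<close> the exponent \<open>1 / real n\<close> is 0 by
    convention and the equation can fail, hence only eventual equality.\<close>
  moreover have "\<forall>\<^sub>F n in sequentially.
      a * \<bar>x n / a ^ n\<bar> powr (1 / real n) = \<bar>x n\<bar> powr (1 / real n)"
    using eventually_gt_at_top[of 0]
  proof eventually_elim
    case (elim n)
    have "(a ^ n) powr (1 / real n) = a"
      using elim \<open>a > 0\<close> by (simp add: powr_powr flip: powr_realpow)
    then show ?case
      using \<open>a > 0\<close> by (simp add: abs_divide powr_divide)
  qed
  ultimately show ?thesis
    by (simp add: tendsto_cong)
qed

text \<open>The constant is the distance from \<open>q * \<xi>\<close> to its nearest integer, which
  is nonzero by irrationality.\<close>

lemma irrational_approx_gap:
  fixes \<xi> :: real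
  assumes "\<xi> \<notin> \<rat>" and "(q::int) \<noteq> 0"
  shows "\<exists>c>0. \<forall>p::int. c \<le> \<bar>of_int q * \<xi> - of_int p\<bar>"
proof (intro exI conjI allI)
  have "of_int q * \<xi> \<noteq> of_int (round (of_int q * \<xi>))"
  proof
    assume "of_int q * \<xi> = of_int (round (of_int q * \<xi>))"
    then have "\<xi> = of_int (round (of_int q * \<xi>)) / of_int q"
      using \<open>q \<noteq> 0\<close> by (simp add: field_simps)
    then show False
      using \<open>\<xi> \<notin> \<rat>\<close> by (metis Rats_divide Rats_of_int)
  qed
  then show "0 < \<bar>of_int q * \<xi> - of_int (round (of_int q * \<xi>))\<bar>" by simp
  show "\<bar>of_int q * \<xi> - of_int (round (of_int q * \<xi>))\<bar> \<le> \<bar>of_int q * \<xi> - of_int p\<bar>" for p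
    by (rule round_diff_minimal)
qed

text \<open>This turns the asymptotic definition into a bound for every positive denominator: large
  \<open>q\<close> obey the inequality for some \<open>\<mu>' < \<mu>\<close>, and the finitely many
  others are absorbed into \<open>c\<close>.\<close>

lemma irrationality_exponent_uniform_bound:
  fixes \<xi> \<mu> :: real
  assumes irr: "\<xi> \<notin> \<rat>" and "irrationality_exponent \<xi> < ereal \<mu>"
  obtains c where "c > 0"
    and "\<And>p q :: int. q > 0 \<Longrightarrow> c * of_int q powr (1 - \<mu>) \<le> \<bar>of_int q * \<xi> - of_int p\<bar>"
proof -
  obtain \<mu>' where "\<mu>' < \<mu>"
    and "\<forall>\<^sub>F q :: int in at_top. \<forall>p :: int. \<bar>\<xi> - of_int p / of_int q\<bar> > of_int q powr (- \<mu>')"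
    using assms(2) unfolding irrationality_exponent_def Inf_less_iff by auto
  then obtain q0 where q0:
    "\<And>p q :: int. q \<ge> q0 \<Longrightarrow> \<bar>\<xi> - of_int p / of_int q\<bar> > of_int q powr (- \<mu>')"
    unfolding eventually_at_top_linorder by auto
  \<comment> \<open>The maximum with 1 keeps \<open>Q\<close> nonempty, so that the later
    \<open>Min\<close> is meaningful.\<close>
  define Q where "Q = {1..max q0 1}"
  obtain g where g: "\<And>q :: int. q \<noteq> 0 \<Longrightarrow> g q > 0"
    "\<And>q p :: int. q \<noteq> 0 \<Longrightarrow> g q \<le> \<bar>of_int q * \<xi> - of_int p\<bar>"
    using irrational_approx_gap[OF irr] by metis
  \<comment> \<open>\<open>h q\<close> is the largest constant that the gap \<open>g q\<close>
    permits at denominator \<open>q\<close>; beyond \<open>Q\<close> the constant 1 suffices, whence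
    the \<open>min 1\<close> in \<open>c\<close>.\<close>
  define h where "h q = g q / of_int q powr (1 - \<mu>)" for q
  define c where "c = min 1 (Min (h ` Q))"
  have Q: "finite Q" "Q \<noteq> {}" by (auto simp: Q_def)
  have "h q > 0" if "q \<in> Q" for q
    using that g(1)[of q] by (auto simp: h_def Q_def)
  then have "c > 0"
    using Q by (simp add: c_def)
  moreover have "c * of_int q powr (1 - \<mu>) \<le> \<bar>of_int q * \<xi> - of_int p\<bar>" if "q > 0" for p q :: int
  proof (cases "q \<in> Q")
    case True
    then have "c \<le> h q"
      using Q by (auto simp: c_def intro: min.coboundedI2)
    then have "c * of_int q powr (1 - \<mu>) \<le> g q"
      using that by (simp add: h_def field_simps)
    with g(2)[of q p] that show ?thesis by linarith
  next
    case False
    then have "q \<ge> q0"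
      using that by (auto simp: Q_def)
    have "c * of_int q powr (1 - \<mu>) \<le> of_int q powr (1 - \<mu>)"
      using \<open>c > 0\<close> by (intro mult_left_le_one_le) (auto simp: c_def)
    also have "\<dots> \<le> of_int q powr (1 - \<mu>')"
      using \<open>\<mu>' < \<mu>\<close> that by (intro powr_mono) auto
    also have "\<dots> = of_int q * of_int q powr (- \<mu>')"
      using that by (simp add: powr_diff powr_minus divide_simps)
    also have "\<dots> \<le> of_int q * \<bar>\<xi> - of_int p / of_int q\<bar>"
      using q0[OF \<open>q \<ge> q0\<close>, of p] that by (intro mult_left_mono) auto
    also have "\<dots> = \<bar>of_int q * (\<xi> - of_int p / of_int q)\<bar>"
      using that by (simp add: abs_mult)
    also have "\<dots> = \<bar>of_int q * \<xi> - of_int p\<bar>"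
      using that by (simp add: right_diff_distrib)
    finally show ?thesis .
  qed
  ultimately show ?thesis by (rule that)
qed

text \<open>As \<open>p\<close> is invertible modulo \<open>q\<close>, some \<open>k\<close> makes
  \<open>k * p\<close> congruent to the floor of \<open>t * q\<close>, so \<open>k * p / q\<close>
  is within \<open>1 / q\<close> of \<open>t\<close> modulo 1. Replacing \<open>p / q\<close> by
  \<open>\<xi>\<close> costs \<open>k / q < 1\<close> times the Dirichlet error.\<close>

lemma inhomogeneous_approx:
  fixes \<xi> t :: real and p q :: int
  assumes "q > 0" and "coprime p q"
  obtains k v :: int where "0 \<le> k" and "k < q"
    and "\<bar>of_int k * \<xi> - of_int v - t\<bar> \<le> 1 / of_int q + \<bar>of_int q * \<xi> - of_int p\<bar>"
proof -
  define m where "m = \<lfloor>t * of_int q\<rfloor>"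
  obtain r where r: "[p * r = 1] (mod q)"
    using cong_solve_coprime_int[OF \<open>coprime p q\<close>] by auto
  define k where "k = (r * m) mod q"
  have "[p * k = p * (r * m)] (mod q)"
    by (simp add: k_def cong_def mod_mult_right_eq)
  also have "[p * (r * m) = m] (mod q)"
    using cong_mult[OF r cong_refl[of m]] by (simp add: mult.assoc)
  finally obtain v where v: "p * k = m + q * v"
    by (metis cong_iff_lin cong_sym)
  have k: "0 \<le> k" "k < q"
    using \<open>q > 0\<close> by (auto simp: k_def)
  have "of_int p * of_int k = of_int m + of_int q * (of_int v :: real)"
    using v by (metis of_int_add of_int_mult)
  then have "of_int k * \<xi> - of_int v - t
      = (of_int m - t * of_int q) / of_int q
        + of_int k / of_int q * (of_int q * \<xi> - of_int p)"
    using \<open>q > 0\<close> by (simp add: field_simps)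
  also have "\<bar>\<dots>\<bar> \<le> \<bar>(of_int m - t * of_int q) / of_int q\<bar>
        + \<bar>of_int k / of_int q * (of_int q * \<xi> - of_int p)\<bar>"
    by (rule abs_triangle_ineq)
  also have "\<bar>(of_int m - t * of_int q) / of_int q\<bar> \<le> 1 / of_int q"
  proof -
    have "\<bar>of_int m - t * of_int q\<bar> \<le> 1"
      unfolding m_def by linarith
    then show ?thesis
      using \<open>q > 0\<close> by (simp add: divide_right_mono)
  qed
  also have "\<bar>of_int k / of_int q * (of_int q * \<xi> - of_int p)\<bar> \<le> \<bar>of_int q * \<xi> - of_int p\<bar>"
    using k unfolding abs_mult by (intro mult_left_le_one_le) auto
  finally show ?thesis
    using k that[of k v] by simp
qed

lemma geometric_approx:
  fixes \<xi> s t b \<mu> c :: real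
  assumes "c > 0" and "b > 1" and "\<mu> > 1"
    and gap: "\<And>p q :: int. q > 0 \<Longrightarrow> c * of_int q powr (1 - \<mu>) \<le> \<bar>of_int q * \<xi> - of_int p\<bar>"
  defines "C \<equiv> 2 * (2 / c) powr (1 / (\<mu> - 1))" and "\<gamma> \<equiv> b powr (- 1 / (\<mu> - 1))"
  obtains u v :: int
  where "\<bar>of_int u - s\<bar> \<le> 1 + b ^ n" and "\<bar>of_int u * \<xi> - of_int v - t\<bar> \<le> C * \<gamma> ^ n"
proof -
  define N where "N = nat \<lfloor>b ^ n\<rfloor>"
  have "b ^ n \<ge> 1"
    using \<open>b > 1\<close> by simp
  then have "real N = of_int \<lfloor>b ^ n\<rfloor>" "\<lfloor>b ^ n\<rfloor> \<ge> 1"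
    by (auto simp: N_def)
  \<comment> \<open>The second bound is \<open>b ^ n < N + 1 \<le> 2 * N\<close>; it yields the 2 in
    \<open>2 / c\<close>.\<close>
  then have N: "real N \<le> b ^ n" "b ^ n \<le> 2 * real N" "N > 0"
    by linarith+
  obtain p q where pq: "coprime p q" "0 < q" "q \<le> int N" "\<bar>of_int q * \<xi> - of_int p\<bar> < 1 / N"
    using Dirichlet_approx_coprime[OF \<open>N > 0\<close>, of \<xi>] by metis
  define w where "w = \<bar>of_int q * \<xi> - of_int p\<bar>"
  \<comment> \<open>The target is shifted by \<open>\<lfloor>s\<rfloor> * \<xi>\<close> because
    \<open>u\<close> will be \<open>\<lfloor>s\<rfloor> + k\<close>.\<close>
  obtain k v where k: "0 \<le> k" "k < q"
    and v: "\<bar>of_int k * \<xi> - of_int v - (t - of_int \<lfloor>s\<rfloor> * \<xi>)\<bar> \<le> 1 / of_int q + w"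
    using inhomogeneous_approx[OF pq(2,1)] unfolding w_def by metis
  have "real_of_int q \<le> real N"
    using pq by (metis of_int_le_iff of_int_of_nat_eq)
  then have "1 / real N \<le> 1 / of_int q"
    using pq by (simp add: frac_le)
  \<comment> \<open>Here \<open>w < 1 / N \<le> 1 / q\<close>; this gives the outer factor 2 of
    \<open>C\<close>.\<close>
  then have "1 / of_int q + w \<le> 2 * (1 / of_int q)"
    using pq unfolding w_def by linarith
  \<comment> \<open>The gap bound and the Dirichlet bound together keep \<open>q\<close> from being
    small; the power \<open>1 / (\<mu> - 1)\<close> turns \<open>q powr (1 - \<mu>)\<close> into
    \<open>1 / q\<close>.\<close>
  also have "1 / of_int q \<le> (2 / c * (1 / b ^ n)) powr (1 / (\<mu> - 1))"
  proof -
    have "c * of_int q powr (1 - \<mu>) \<le> 1 / real N"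
      using gap[OF pq(2), of p] pq(4) by linarith
    also have "\<dots> \<le> 2 / b ^ n"
      using N \<open>b ^ n \<ge> 1\<close> by (simp add: field_simps)
    finally have "of_int q powr (1 - \<mu>) \<le> 2 / c * (1 / b ^ n)"
      using \<open>c > 0\<close> \<open>b > 1\<close> by (simp add: field_simps)
    then have "(of_int q powr (1 - \<mu>)) powr (1 / (\<mu> - 1)) \<le> (2 / c * (1 / b ^ n)) powr (1 / (\<mu> - 1))"
      using \<open>\<mu> > 1\<close> by (intro powr_mono2) auto
    moreover have "(1 - \<mu>) * (1 / (\<mu> - 1)) = -1"
      using \<open>\<mu> > 1\<close> by (simp add: field_simps)
    then have "(of_int q powr (1 - \<mu>)) powr (1 / (\<mu> - 1)) = 1 / of_int q"
      using pq(2) unfolding powr_powr by (simp add: powr_minus divide_inverse)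
    ultimately show ?thesis by simp
  qed
  also have "(2 / c * (1 / b ^ n)) powr (1 / (\<mu> - 1)) = (2 / c) powr (1 / (\<mu> - 1)) * \<gamma> ^ n"
  proof -
    have "(1 / b ^ n) = b powr (- real n)"
      using \<open>b > 1\<close> by (simp add: powr_minus powr_realpow divide_inverse)
    then have "(1 / b ^ n) powr (1 / (\<mu> - 1)) = \<gamma> ^ n"
      using \<open>b > 1\<close> by (simp add: \<gamma>_def powr_powr mult.commute flip: powr_realpow)
    then show ?thesis
      using \<open>c > 0\<close> \<open>b > 1\<close> by (simp only: powr_mult)
  qed
  finally have "1 / of_int q + w \<le> C * \<gamma> ^ n"
    by (simp add: C_def)
  then have "\<bar>of_int (\<lfloor>s\<rfloor> + k) * \<xi> - of_int v - t\<bar> \<le> C * \<gamma> ^ n"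
    using v by (simp add: algebra_simps)
  moreover have "real_of_int k \<le> b ^ n"
    using k N \<open>real_of_int q \<le> real N\<close> by linarith
  \<comment> \<open>The 1 accounts for the floor of \<open>s\<close>, and \<open>b ^ n\<close> for
    \<open>k\<close>.\<close>
  then have "\<bar>of_int (\<lfloor>s\<rfloor> + k) - s\<bar> \<le> 1 + b ^ n"
    using k by (simp add: abs_le_iff) linarith
  ultimately show ?thesis using that by blast
qed

text \<open>After division by \<open>a ^ n\<close> the error is at most
  \<open>C * (r / a) ^ n\<close>, a null sequence since \<open>r < a\<close>.\<close>

lemma asymp_power_of_diff_bound:
  fixes x :: "nat \<Rightarrow> real"
  assumes "a > 0" and bound: "\<And>n. \<bar>x n - a ^ n\<bar> \<le> C * r ^ n" and "0 \<le> r" "r < a"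
  shows "(\<lambda>n. x n / a ^ n) \<longlonglongrightarrow> 1"
proof -
  have "(\<lambda>n. C * (r / a) ^ n) \<longlonglongrightarrow> C * 0"
    using assms by (intro tendsto_intros LIMSEQ_power_zero) simp
  then have "(\<lambda>n. x n / a ^ n - 1) \<longlonglongrightarrow> 0"
  proof (rule Lim_null_comparison[OF always_eventually, rotated, OF tendsto_eq_rhs])
    show "\<forall>n. norm (x n / a ^ n - 1) \<le> C * (r / a) ^ n"
    proof
      fix n
      have "x n / a ^ n - 1 = (x n - a ^ n) / a ^ n"
        using \<open>a > 0\<close> by (simp add: diff_divide_distrib)
      then have "norm (x n / a ^ n - 1) = \<bar>x n - a ^ n\<bar> / a ^ n"
        using \<open>a > 0\<close> by (simp add: abs_divide)
      also have "\<dots> \<le> C * r ^ n / a ^ n"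
        using \<open>a > 0\<close> bound by (intro divide_right_mono) auto
      finally show "norm (x n / a ^ n - 1) \<le> C * (r / a) ^ n"
        by (simp add: power_divide)
    qed
  qed simp
  then show ?thesis
    by (simp add: LIM_zero_iff)
qed

theorem theorem1:
  fixes \<xi> \<alpha> \<beta> :: real
  assumes "\<xi> \<notin> \<rat>"
    and "0 < \<alpha>" and "\<alpha> < 1" and "\<beta> > 1"
    and "irrationality_exponent \<xi> < ereal (1 - ln \<beta> / ln \<alpha>)"
  shows "\<exists>u v :: nat \<Rightarrow> int.
      ((\<lambda>n. (of_int (u n) * \<xi> - of_int (v n)) / \<alpha> ^ n) \<longlonglongrightarrow> 1) \<and>
      ((\<lambda>n. of_int (u n) / \<beta> ^ n) \<longlonglongrightarrow> 1) \<and>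
      ((\<lambda>n. \<bar>of_int (u (Suc n)) * \<xi> - of_int (v (Suc n))\<bar> /
             \<bar>of_int (u n) * \<xi> - of_int (v n)\<bar>) \<longlonglongrightarrow> \<alpha>) \<and>
      ((\<lambda>n. \<bar>of_int (u n) * \<xi> - of_int (v n)\<bar> powr (1 / real n)) \<longlonglongrightarrow> \<alpha>) \<and>
      ((\<lambda>n. of_int (u (Suc n)) / of_int (u n)) \<longlonglongrightarrow> \<beta>) \<and>
      ((\<lambda>n. \<bar>of_int (u n)\<bar> powr (1 / real n)) \<longlonglongrightarrow> \<beta>)"
proof -
  define M where "M = 1 - ln \<beta> / ln \<alpha>"
  have "ln \<alpha> < 0" "ln \<beta> > 0"
    using assms by auto
  then have "M > 1"
    by (simp add: M_def divide_less_0_iff)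
  \<comment> \<open>The maximum with 1 forces the chosen \<open>\<mu>\<close> above 1, making
    \<open>1 / (\<mu> - 1)\<close> positive.\<close>
  then have "max (irrationality_exponent \<xi>) (ereal 1) < ereal M"
    using assms(5) by (simp add: M_def)
  then obtain \<mu> where "max (irrationality_exponent \<xi>) (ereal 1) < ereal \<mu>" "ereal \<mu> < ereal M"
    using ereal_dense2 by blast
  then have \<mu>: "irrationality_exponent \<xi> < ereal \<mu>" "\<mu> > 1" "\<mu> < M"
    by auto
  obtain c where "c > 0"
    and c: "\<And>p q :: int. q > 0 \<Longrightarrow> c * of_int q powr (1 - \<mu>) \<le> \<bar>of_int q * \<xi> - of_int p\<bar>"
    using irrationality_exponent_uniform_bound[OF assms(1) \<mu>(1)] by blast
  have "- ln \<alpha> * (\<mu> - 1) < ln \<beta>"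
    using \<mu>(3) \<open>ln \<alpha> < 0\<close> by (simp add: M_def field_simps)
  moreover have "0 < - ln \<alpha> * (\<mu> - 1)"
    using \<open>ln \<alpha> < 0\<close> \<mu>(2) by (simp add: mult_neg_pos)
  \<comment> \<open>\<open>y\<close> is the logarithm of \<open>b\<close>: the three bounds become
    \<open>\<gamma> < \<alpha>\<close>, \<open>b > 1\<close> and \<open>b < \<beta>\<close>
    respectively.\<close>
  ultimately obtain y where y: "- ln \<alpha> * (\<mu> - 1) < y" "0 < y" "y < ln \<beta>"
    using dense by (metis less_trans)
  define b where "b = exp y"
  define \<gamma> where "\<gamma> = b powr (- 1 / (\<mu> - 1))"
  define C where "C = 2 * (2 / c) powr (1 / (\<mu> - 1))"
  have b: "b > 1" "b < \<beta>"
    using y assms(4) exp_less_mono[OF y(3)] by (auto simp: b_def)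
  have "- y / (\<mu> - 1) < ln \<alpha>"
    using y(1) \<mu>(2) by (simp add: field_simps)
  then have \<gamma>: "0 \<le> \<gamma>" "\<gamma> < \<alpha>"
    using assms(2) exp_less_mono[of "- y / (\<mu> - 1)" "ln \<alpha>"] by (auto simp: \<gamma>_def b_def powr_def)
  have "\<exists>u v :: int. \<bar>of_int u - \<beta> ^ n\<bar> \<le> 1 + b ^ n \<and>
      \<bar>of_int u * \<xi> - of_int v - \<alpha> ^ n\<bar> \<le> C * \<gamma> ^ n" for n
    using geometric_approx[OF \<open>c > 0\<close> b(1) \<mu>(2) c] unfolding C_def \<gamma>_def by metis
  then obtain u v :: "nat \<Rightarrow> int" where
    u: "\<And>n. \<bar>of_int (u n) - \<beta> ^ n\<bar> \<le> 1 + b ^ n" and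
    v: "\<And>n. \<bar>of_int (u n) * \<xi> - of_int (v n) - \<alpha> ^ n\<bar> \<le> C * \<gamma> ^ n"
    by metis
  have lim_v: "(\<lambda>n. (of_int (u n) * \<xi> - of_int (v n)) / \<alpha> ^ n) \<longlonglongrightarrow> 1"
    by (rule asymp_power_of_diff_bound[OF assms(2) v \<gamma>])
  \<comment> \<open>Since \<open>b ^ n \<ge> 1\<close>, the additive 1 is absorbed to give a purely
    geometric error.\<close>
  have "\<bar>of_int (u n) - \<beta> ^ n\<bar> \<le> 2 * b ^ n" for n
    using u[of n] one_le_power[of b n] b by linarith
  then have lim_u: "(\<lambda>n. of_int (u n) / \<beta> ^ n) \<longlonglongrightarrow> 1"
    using assms(4) b by (intro asymp_power_of_diff_bound[of \<beta> _ 2 b]) auto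
  have "(\<lambda>n. \<bar>of_int (u (Suc n)) * \<xi> - of_int (v (Suc n))\<bar> /
             \<bar>of_int (u n) * \<xi> - of_int (v n)\<bar>) \<longlonglongrightarrow> \<bar>\<alpha>\<bar>"
    using tendsto_rabs[OF tendsto_ratio_of_asymp_power[OF assms(2) lim_v]]
    by (simp add: abs_divide)
  then show ?thesis
    using lim_u lim_v assms tendsto_ratio_of_asymp_power[OF _ lim_u]
      tendsto_root_of_asymp_power[OF _ lim_u] tendsto_root_of_asymp_power[OF _ lim_v]
    by (intro exI[of _ u] exI[of _ v]) auto
qed

end
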